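(* Let $(\pi,\overline{\lambda})$ be an optimal solution of the dual of the SC-ST clearing problem. Then the clearing prices satisfy $\pi_i-\overline{\lambda}_i\le\alpha^g_i$ for all $i\in\mathcal{G}$, $\pi_j+\overline{\lambda}_j\ge\alpha^d_j$ for all $j\in\mathcal{D}$, $\pi_l-\overline{\lambda}_l\le\alpha^f_l$ for all $l\in\mathcal{L}$, and $\pi_m-\overline{\lambda}_m\le\alpha^\xi_m$ for all $m\in\mathcal{M}$.
   Context: Setting (space-time supply chain, SC-ST). $\mathcal{N}$ is a finite set of spatial nodes, $\mathcal{T}$ a finite ordered set of times, $\mathcal{S}=\mathcal{N}\times\mathcal{T}$ the set of space-time nodes $s=(n,t)$, $\mathcal{P}$ a finite set of products. There are finite sets of stakeholders (players): suppliers $\mathcal{G}$, consumers $\mathcal{D}$, transport providers $\mathcal{L}$, technology providers $\mathcal{M}$. - Supplier $i$: node $s(i)\in\mathcal{S}$, product $p(i)\in\mathcal{P}$, flow $g_i\ge0$, capacity $\overline{g}_i\ge0$, bid $\alpha^g_i\in\mathbb{R}$. - Consumer $j$: node $s(j)\in\mathcal{S}$, product $p(j)\in\mathcal{P}$, flow $d_j\ge0$, capacity $\overline{d}_j\ge0$, bid $\alpha^d_j\in\mathbb{R}$. - Transport provider $l$: base node $s_b(l)\in\mathcal{S}$, receiving node $s_r(l)\in\mathcal{S}$, product $p(l)\in\mathcal{P}$, flow $f_l\ge0$, capacity $\overline{f}_l\ge0$, bid $\alpha^f_l\ge0$. - Technology provider $m$: node $s(m)\in\mathcal{S}$, sets $\mathcal{P}^{con}_m,\mathcal{P}^{gen}_m\subset\mathcal{P}$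 of consumed and generated products, yields $\gamma_{m,p}\ge0$ with $\gamma_{m,\bar p_m}=1$ for a reference product $\bar p_m\in\mathcal{P}^{con}_m$, flow $\xi_m\ge0$, capacity $\overline{\xi}_m\ge0$, bid $\alpha^\xi_m\ge0$. For $(s,p)\in\mathcal{S}\times\mathcal{P}$: $\mathcal{G}_{s,p}=\{i:s(i)=s,p(i)=p\}$, $\mathcal{D}_{s,p}=\{j:s(j)=s,p(j)=p\}$, $\mathcal{L}^{in}_{s,p}=\{l:s_r(l)=s,p(l)=p\}$, $\mathcal{L}^{out}_{s,p}=\{l:s_b(l)=s,p(l)=p\}$, $\mathcal{M}^{con}_{s,p}=\{m:s(m)=s,p\in\mathcal{P}^{con}_m\}$, $\mathcal{M}^{gen}_{s,p}=\{m:s(m)=s,p\in\mathcal{P}^{gen}_m\}$. SC-ST clearing problem (primal): maximize $\sum_j\alpha^d_jd_j-\sum_i\alpha^g_ig_i-\sum_l\alpha^f_lf_l-\sum_m\alpha^\xi_m\xi_m$ over nonnegative $(g,d,f,\xi)$ subject to the clearing constraints, for all $(s,p)\in\mathcal{S}\times\mathcal{P}$ (dual variable $\pi_{s,p}\in\mathbb{R}$, the clearing price), $$\sum_{i\in\mathcal{G}_{s,p}}g_i+\sum_{l\in\mathcal{L}^{in}_{s,p}}f_l+\sum_{m\in\mathcal{M}^{gen}_{s,p}}\gamma_{m,p}\xi_m=\sum_{j\in\mathcal{D}_{s,p}}d_j+\sum_{l\in\mathcal{L}^{out}_{s,p}}f_l+\sum_{m\in\mathcal{M}^{con}_{s,p}}\gamma_{m,p}\xi_m,$$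 and capacity constraints $g_i\le\overline{g}_i$, $d_j\le\overline{d}_j$, $f_l\le\overline{f}_l$, $\xi_m\le\overline{\xi}_m$, with corresponding dual variables $\overline{\lambda}_i,\overline{\lambda}_j,\overline{\lambda}_l,\overline{\lambda}_m\ge0$. The dual of this problem is its standard linear-programming dual (a minimization of $\sum_i\overline{g}_i\overline{\lambda}_i+\sum_j\overline{d}_j\overline{\lambda}_j+\sum_l\overline{f}_l\overline{\lambda}_l+\sum_m\overline{\xi}_m\overline{\lambda}_m$ over free $\pi$ and $\overline{\lambda}\ge0$), with the sign of $\pi$ chosen so that $\pi_{s,p}$ multiplies (left-hand side minus right-hand side) of the clearing constraint in the Lagrangian as $+\pi_{s,p}$ when minimizing the negative of the primal objective with that term subtracted, i.e. Lagrangian $= -(\text{objective})-\sum_{s,p}\pi_{s,p}(\text{LHS}-\text{RHS})+\sum_u\overline{\lambda}_u(x_u-\overline{x}_u)$, where $u$ runs over all players, $x_u$ is the player's flow and $\overline{x}_u$ its capacity. Stakeholder prices: $\pi_i=\pi_{s(i),p(i)}$, $\pi_j=\pi_{s(j),p(j)}$, $\pi_l=\pi_{s_r(l),p(l)}-\pi_{s_b(l),p(l)}$, $\pi_m=\sum_{p\in\mathcal{P}^{gen}_m}\gamma_{m,p}\pi_{s(m),p}-\sum_{p\in\mathcal{P}^{con}_m}\gamma_{m,p}\pi_{s(m),p}$. *)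

theory Defs
  imports Complex_Main
begin

section \<open>Linear programs and their duals\<close>

text \<open>Maximize \<open>\<Sum>v. c v * x v\<close> over \<open>x \<ge> 0\<close> subject to \<open>A x = b\<close> and \<open>B x \<le> h\<close>. The index sets are
  explicit finite sets, so that each of them may be empty.\<close>

record ('v, 'e, 'r) lin_prog =
  lp_vars :: "'v set"
  lp_eqs :: "'e set"
  lp_ineqs :: "'r set"
  lp_cost :: "'v \<Rightarrow> real"
  eq_coeff :: "'e \<Rightarrow> 'v \<Rightarrow> real"
  eq_rhs :: "'e \<Rightarrow> real"
  le_coeff :: "'r \<Rightarrow> 'v \<Rightarrow> real"
  le_rhs :: "'r \<Rightarrow> real"

definition lp_objective :: "('v, 'e, 'r) lin_prog \<Rightarrow> ('v \<Rightarrow> real) \<Rightarrow> real" where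
  "lp_objective P x = (\<Sum>v\<in>lp_vars P. lp_cost P v * x v)"

definition lp_feasible :: "('v, 'e, 'r) lin_prog \<Rightarrow> ('v \<Rightarrow> real) \<Rightarrow> bool" where
  "lp_feasible P x \<longleftrightarrow>
     (\<forall>v\<in>lp_vars P. 0 \<le> x v) \<and>
     (\<forall>e\<in>lp_eqs P. (\<Sum>v\<in>lp_vars P. eq_coeff P e v * x v) = eq_rhs P e) \<and>
     (\<forall>r\<in>lp_ineqs P. (\<Sum>v\<in>lp_vars P. le_coeff P r v * x v) \<le> le_rhs P r)"

definition lp_dual_objective ::
    "('v, 'e, 'r) lin_prog \<Rightarrow> ('e \<Rightarrow> real) \<Rightarrow> ('r \<Rightarrow> real) \<Rightarrow> real" where
  "lp_dual_objective P y z =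
     (\<Sum>e\<in>lp_eqs P. eq_rhs P e * y e) + (\<Sum>r\<in>lp_ineqs P. le_rhs P r * z r)"

definition lp_dual_feasible ::
    "('v, 'e, 'r) lin_prog \<Rightarrow> ('e \<Rightarrow> real) \<Rightarrow> ('r \<Rightarrow> real) \<Rightarrow> bool" where
  "lp_dual_feasible P y z \<longleftrightarrow>
     (\<forall>r\<in>lp_ineqs P. 0 \<le> z r) \<and>
     (\<forall>v\<in>lp_vars P.
        (\<Sum>e\<in>lp_eqs P. eq_coeff P e v * y e) + (\<Sum>r\<in>lp_ineqs P. le_coeff P r v * z r)
          \<ge> lp_cost P v)"

definition lp_dual_optimal ::
    "('v, 'e, 'r) lin_prog \<Rightarrow> ('e \<Rightarrow> real) \<Rightarrow> ('r \<Rightarrow> real) \<Rightarrow> bool" where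
  "lp_dual_optimal P y z \<longleftrightarrow>
     lp_dual_feasible P y z \<and>
     (\<forall>y' z'. lp_dual_feasible P y' z' \<longrightarrow> lp_dual_objective P y z \<le> lp_dual_objective P y' z')"


section \<open>Space-time supply chains\<close>

text \<open>Only the yields \<open>tech_yield m p\<close> with \<open>p\<close> consumed or generated by \<open>m\<close> are meaningful.\<close>

record ('n, 't, 'p, 'g, 'd, 'l, 'm) supply_chain =
  spatial_nodes :: "'n set"
  time_points :: "'t set"
  products :: "'p set"
  suppliers :: "'g set"
  sup_node :: "'g \<Rightarrow> 'n \<times> 't"
  sup_product :: "'g \<Rightarrow> 'p"
  sup_cap :: "'g \<Rightarrow> real"
  sup_bid :: "'g \<Rightarrow> real"
  consumers :: "'d set"
  con_node :: "'d \<Rightarrow> 'n \<times> 't"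
  con_product :: "'d \<Rightarrow> 'p"
  con_cap :: "'d \<Rightarrow> real"
  con_bid :: "'d \<Rightarrow> real"
  transporters :: "'l set"
  base_node :: "'l \<Rightarrow> 'n \<times> 't"
  recv_node :: "'l \<Rightarrow> 'n \<times> 't"
  trans_product :: "'l \<Rightarrow> 'p"
  trans_cap :: "'l \<Rightarrow> real"
  trans_bid :: "'l \<Rightarrow> real"
  technologies :: "'m set"
  tech_node :: "'m \<Rightarrow> 'n \<times> 't"
  tech_con :: "'m \<Rightarrow> 'p set"
  tech_gen :: "'m \<Rightarrow> 'p set"
  tech_yield :: "'m \<Rightarrow> 'p \<Rightarrow> real"
  tech_ref :: "'m \<Rightarrow> 'p"
  tech_cap :: "'m \<Rightarrow> real"
  tech_bid :: "'m \<Rightarrow> real"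

definition st_nodes :: "('n, 't, 'p, 'g, 'd, 'l, 'm) supply_chain \<Rightarrow> ('n \<times> 't) set" where
  "st_nodes C = spatial_nodes C \<times> time_points C"

definition valid_supply_chain ::
    "('n, 't::linorder, 'p, 'g, 'd, 'l, 'm) supply_chain \<Rightarrow> bool" where
  "valid_supply_chain C \<longleftrightarrow>
     finite (spatial_nodes C) \<and> finite (time_points C) \<and> finite (products C) \<and>
     finite (suppliers C) \<and> finite (consumers C) \<and>
     finite (transporters C) \<and> finite (technologies C) \<and>
     (\<forall>i\<in>suppliers C. sup_node C i \<in> st_nodes C \<and> sup_product C i \<in> products C \<and>
        0 \<le> sup_cap C i) \<and>
     (\<forall>j\<in>consumers C. con_node C j \<in> st_nodes C \<and> con_product C j \<in> products C \<and>
        0 \<le> con_cap C j) \<and>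
     (\<forall>l\<in>transporters C. base_node C l \<in> st_nodes C \<and> recv_node C l \<in> st_nodes C \<and>
        trans_product C l \<in> products C \<and> 0 \<le> trans_cap C l \<and> 0 \<le> trans_bid C l) \<and>
     (\<forall>m\<in>technologies C. tech_node C m \<in> st_nodes C \<and>
        tech_con C m \<subseteq> products C \<and> tech_gen C m \<subseteq> products C \<and>
        (\<forall>p\<in>tech_con C m \<union> tech_gen C m. 0 \<le> tech_yield C m p) \<and>
        tech_ref C m \<in> tech_con C m \<and> tech_yield C m (tech_ref C m) = 1 \<and>
        0 \<le> tech_cap C m \<and> 0 \<le> tech_bid C m)"

datatype ('g, 'd, 'l, 'm) player =
  Supplier 'g | Consumer 'd | Transporter 'l | Technology 'm

definition players ::
    "('n, 't, 'p, 'g, 'd, 'l, 'm) supply_chain \<Rightarrow> ('g, 'd, 'l, 'm) player set" where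
  "players C = Supplier ` suppliers C \<union> Consumer ` consumers C \<union>
     Transporter ` transporters C \<union> Technology ` technologies C"

fun capacity ::
    "('n, 't, 'p, 'g, 'd, 'l, 'm) supply_chain \<Rightarrow> ('g, 'd, 'l, 'm) player \<Rightarrow> real" where
  "capacity C (Supplier i) = sup_cap C i"
| "capacity C (Consumer j) = con_cap C j"
| "capacity C (Transporter l) = trans_cap C l"
| "capacity C (Technology m) = tech_cap C m"

definition suppliers_at where
  "suppliers_at C s p = {i\<in>suppliers C. sup_node C i = s \<and> sup_product C i = p}"

definition consumers_at where
  "consumers_at C s p = {j\<in>consumers C. con_node C j = s \<and> con_product C j = p}"

definition transporters_in where
  "transporters_in C s p = {l\<in>transporters C. recv_node C l = s \<and> trans_product C l = p}"

definition transporters_out where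
  "transporters_out C s p = {l\<in>transporters C. base_node C l = s \<and> trans_product C l = p}"

definition technologies_con where
  "technologies_con C s p = {m\<in>technologies C. tech_node C m = s \<and> p \<in> tech_con C m}"

definition technologies_gen where
  "technologies_gen C s p = {m\<in>technologies C. tech_node C m = s \<and> p \<in> tech_gen C m}"


section \<open>The clearing problem\<close>

text \<open>A flow \<open>x\<close> assigns to every player its allocation: \<open>g\<close>, \<open>d\<close>, \<open>f\<close> and \<open>\<xi>\<close> are the restrictions
  of \<open>x\<close> to the four kinds of players.\<close>

definition clearing_objective ::
    "('n, 't, 'p, 'g, 'd, 'l, 'm) supply_chain \<Rightarrow> (('g, 'd, 'l, 'm) player \<Rightarrow> real) \<Rightarrow> real" where
  "clearing_objective C x =
     (\<Sum>j\<in>consumers C. con_bid C j * x (Consumer j))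
     - (\<Sum>i\<in>suppliers C. sup_bid C i * x (Supplier i))
     - (\<Sum>l\<in>transporters C. trans_bid C l * x (Transporter l))
     - (\<Sum>m\<in>technologies C. tech_bid C m * x (Technology m))"

definition inflow ::
    "('n, 't, 'p, 'g, 'd, 'l, 'm) supply_chain \<Rightarrow> (('g, 'd, 'l, 'm) player \<Rightarrow> real)
      \<Rightarrow> ('n \<times> 't) \<times> 'p \<Rightarrow> real" where
  "inflow C x = (\<lambda>(s, p).
     (\<Sum>i\<in>suppliers_at C s p. x (Supplier i))
     + (\<Sum>l\<in>transporters_in C s p. x (Transporter l))
     + (\<Sum>m\<in>technologies_gen C s p. tech_yield C m p * x (Technology m)))"

definition outflow ::
    "('n, 't, 'p, 'g, 'd, 'l, 'm) supply_chain \<Rightarrow> (('g, 'd, 'l, 'm) player \<Rightarrow> real)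
      \<Rightarrow> ('n \<times> 't) \<times> 'p \<Rightarrow> real" where
  "outflow C x = (\<lambda>(s, p).
     (\<Sum>j\<in>consumers_at C s p. x (Consumer j))
     + (\<Sum>l\<in>transporters_out C s p. x (Transporter l))
     + (\<Sum>m\<in>technologies_con C s p. tech_yield C m p * x (Technology m)))"

definition clearing_feasible ::
    "('n, 't, 'p, 'g, 'd, 'l, 'm) supply_chain \<Rightarrow> (('g, 'd, 'l, 'm) player \<Rightarrow> real) \<Rightarrow> bool" where
  "clearing_feasible C x \<longleftrightarrow>
     (\<forall>u\<in>players C. 0 \<le> x u) \<and>
     (\<forall>k\<in>st_nodes C \<times> products C. inflow C x k = outflow C x k) \<and>
     (\<forall>u\<in>players C. x u \<le> capacity C u)"

definition unit_flow :: "('g, 'd, 'l, 'm) player \<Rightarrow> ('g, 'd, 'l, 'm) player \<Rightarrow> real" where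
  "unit_flow u v = (if v = u then 1 else 0)"

text \<open>The coefficients of the objective and of the clearing constraints are their values at unit
  flows. The clearing constraints enter as \<open>outflow - inflow = 0\<close>; this orientation is what gives
  the clearing prices their sign, see \<open>lagrangian_eq\<close> below.\<close>

definition clearing_lp ::
    "('n, 't, 'p, 'g, 'd, 'l, 'm) supply_chain \<Rightarrow>
      (('g, 'd, 'l, 'm) player, ('n \<times> 't) \<times> 'p, ('g, 'd, 'l, 'm) player) lin_prog" where
  "clearing_lp C = \<lparr>
     lp_vars = players C,
     lp_eqs = st_nodes C \<times> products C,
     lp_ineqs = players C,
     lp_cost = (\<lambda>u. clearing_objective C (unit_flow u)),
     eq_coeff = (\<lambda>k u. outflow C (unit_flow u) k - inflow C (unit_flow u) k),
     eq_rhs = (\<lambda>k. 0),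
     le_coeff = (\<lambda>r u. unit_flow u r),
     le_rhs = capacity C \<rparr>"

definition lagrangian ::
    "('n, 't, 'p, 'g, 'd, 'l, 'm) supply_chain \<Rightarrow> (('g, 'd, 'l, 'm) player \<Rightarrow> real)
      \<Rightarrow> (('n \<times> 't) \<times> 'p \<Rightarrow> real) \<Rightarrow> (('g, 'd, 'l, 'm) player \<Rightarrow> real) \<Rightarrow> real" where
  "lagrangian C x \<pi> lam =
     - clearing_objective C x
     - (\<Sum>k\<in>st_nodes C \<times> products C. \<pi> k * (inflow C x k - outflow C x k))
     + (\<Sum>u\<in>players C. lam u * (x u - capacity C u))"

definition clearing_dual_optimal ::
    "('n, 't, 'p, 'g, 'd, 'l, 'm) supply_chain \<Rightarrow> (('n \<times> 't) \<times> 'p \<Rightarrow> real)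
      \<Rightarrow> (('g, 'd, 'l, 'm) player \<Rightarrow> real) \<Rightarrow> bool" where
  "clearing_dual_optimal C \<pi> lam \<longleftrightarrow> lp_dual_optimal (clearing_lp C) \<pi> lam"

definition supplier_price where
  "supplier_price C \<pi> i = \<pi> (sup_node C i, sup_product C i)"

definition consumer_price where
  "consumer_price C \<pi> j = \<pi> (con_node C j, con_product C j)"

definition transporter_price where
  "transporter_price C \<pi> l =
     \<pi> (recv_node C l, trans_product C l) - \<pi> (base_node C l, trans_product C l)"

definition technology_price where
  "technology_price C \<pi> m =
     (\<Sum>p\<in>tech_gen C m. tech_yield C m p * \<pi> (tech_node C m, p))
     - (\<Sum>p\<in>tech_con C m. tech_yield C m p * \<pi> (tech_node C m, p))"


section \<open>The linear program is the clearing problem\<close>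

lemma finite_players: "valid_supply_chain C \<Longrightarrow> finite (players C)"
  by (simp add: players_def valid_supply_chain_def)

lemma sum_players:
  assumes "valid_supply_chain C"
  shows "(\<Sum>u\<in>players C. h u) =
    (\<Sum>i\<in>suppliers C. h (Supplier i)) + (\<Sum>j\<in>consumers C. h (Consumer j))
    + (\<Sum>l\<in>transporters C. h (Transporter l)) + (\<Sum>m\<in>technologies C. h (Technology m))"
proof -
  have fin: "finite (suppliers C)" "finite (consumers C)" "finite (transporters C)"
      "finite (technologies C)"
    using assms by (auto simp: valid_supply_chain_def)
  have "(\<Sum>u\<in>players C. h u) =
      sum h (Supplier ` suppliers C) + sum h (Consumer ` consumers C)
      + sum h (Transporter ` transporters C) + sum h (Technology ` technologies C)"
    unfolding players_def using fin
    by (subst sum.union_disjoint; (auto)?)+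
  also have "\<dots> = (\<Sum>i\<in>suppliers C. h (Supplier i)) + (\<Sum>j\<in>consumers C. h (Consumer j))
    + (\<Sum>l\<in>transporters C. h (Transporter l)) + (\<Sum>m\<in>technologies C. h (Technology m))"
    by (simp add: sum.reindex inj_on_def)
  finally show ?thesis .
qed

lemma sum_filter_delta:
  assumes "finite A"
  shows "(\<Sum>a\<in>A. (\<Sum>b\<in>{b\<in>A. Q b}. f b * (if b = a then 1 else 0)) * h a)
    = (\<Sum>b\<in>{b\<in>A. Q b}. f b * (h b :: real))"
proof -
  have "(\<Sum>b\<in>{b\<in>A. Q b}. f b * (if b = a then 1 else 0)) * h a
      = (if Q a then f a * h a else 0)" if "a \<in> A" for a
  proof -
    have "(\<Sum>b\<in>{b\<in>A. Q b}. f b * (if b = a then 1 else 0))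
        = (\<Sum>b\<in>{b\<in>A. Q b}. if b = a then f b else 0)"
      by (rule sum.cong) auto
    then show ?thesis using assms that by (simp add: sum.delta)
  qed
  then show ?thesis using assms by (simp add: sum.inter_filter)
qed

lemmas sum_filter_delta' = sum_filter_delta[where Q = "\<lambda>_. True", simplified]
lemmas sum_filter_delta1 = sum_filter_delta[where f = "\<lambda>_. 1", simplified]

lemma lp_objective_clearing:
  assumes "valid_supply_chain C"
  shows "lp_objective (clearing_lp C) x = clearing_objective C x"
proof -
  have fin: "finite (suppliers C)" "finite (consumers C)" "finite (transporters C)"
      "finite (technologies C)"
    using assms by (auto simp: valid_supply_chain_def)
  show ?thesis
    unfolding lp_objective_def
    by (simp add: clearing_lp_def sum_players[OF assms] clearing_objective_def unit_flow_def
        sum_filter_delta'[OF fin(1)] sum_filter_delta'[OF fin(2)]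
        sum_filter_delta'[OF fin(3)] sum_filter_delta'[OF fin(4)]
        left_diff_distrib sum_negf fin)
qed

lemma eq_row_clearing:
  assumes "valid_supply_chain C"
  shows "(\<Sum>u\<in>players C. eq_coeff (clearing_lp C) k u * x u) = outflow C x k - inflow C x k"
proof -
  have fin: "finite (suppliers C)" "finite (consumers C)" "finite (transporters C)"
      "finite (technologies C)"
    using assms by (auto simp: valid_supply_chain_def)
  obtain s p where k: "k = (s, p)" by (cases k)
  show ?thesis
    by (simp add: k clearing_lp_def sum_players[OF assms] inflow_def outflow_def unit_flow_def
        suppliers_at_def consumers_at_def transporters_in_def transporters_out_def
        technologies_con_def technologies_gen_def left_diff_distrib sum_subtractf sum_negf
        sum_filter_delta[OF fin(4)] sum_filter_delta1[OF fin(1)] sum_filter_delta1[OF fin(2)]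
        sum_filter_delta1[OF fin(3)])
qed

lemma le_row_clearing:
  assumes "valid_supply_chain C" "r \<in> players C"
  shows "(\<Sum>u\<in>players C. le_coeff (clearing_lp C) r u * x u) = x r"
proof -
  have "(\<Sum>u\<in>players C. le_coeff (clearing_lp C) r u * x u)
      = (\<Sum>u\<in>players C. if r = u then x u else 0)"
    by (rule sum.cong) (auto simp: clearing_lp_def unit_flow_def)
  then show ?thesis using assms(2) finite_players[OF assms(1)] by simp
qed

lemma lp_feasible_clearing:
  assumes "valid_supply_chain C"
  shows "lp_feasible (clearing_lp C) x \<longleftrightarrow> clearing_feasible C x"
proof -
  have "lp_vars (clearing_lp C) = players C" "lp_ineqs (clearing_lp C) = players C"
      "lp_eqs (clearing_lp C) = st_nodes C \<times> products C"
      "eq_rhs (clearing_lp C) = (\<lambda>k. 0)" "le_rhs (clearing_lp C) = capacity C"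
    by (simp_all add: clearing_lp_def)
  then show ?thesis
    unfolding lp_feasible_def clearing_feasible_def
    by (auto simp add: eq_row_clearing[OF assms] le_row_clearing[OF assms])
qed

lemma lp_dual_objective_clearing:
  "lp_dual_objective (clearing_lp C) \<pi> lam = (\<Sum>u\<in>players C. capacity C u * lam u)"
  by (simp add: lp_dual_objective_def clearing_lp_def)

text \<open>The dual objective and the slacks of the dual constraints are, up to the sign of the former,
  the constant and the coefficients of the Lagrangian as an affine function of the flow.\<close>

lemma lagrangian_eq:
  fixes C :: "('n, 't::linorder, 'p, 'g, 'd, 'l, 'm) supply_chain"
  assumes "valid_supply_chain C"
  shows "lagrangian C x \<pi> lam =
    - lp_dual_objective (clearing_lp C) \<pi> lam
    + (\<Sum>u\<in>players C.
        ((\<Sum>k\<in>st_nodes C \<times> products C. eq_coeff (clearing_lp C) k u * \<pi> k)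
         + (\<Sum>r\<in>players C. le_coeff (clearing_lp C) r u * lam r)
         - lp_cost (clearing_lp C) u) * x u)"
proof -
  let ?K = "st_nodes C \<times> products C" and ?P = "clearing_lp C"
  have 1: "(\<Sum>u\<in>players C. (\<Sum>k\<in>?K. eq_coeff ?P k u * \<pi> k) * x u)
      = - (\<Sum>k\<in>?K. \<pi> k * (inflow C x k - outflow C x k))"
  proof -
    have "(\<Sum>u\<in>players C. (\<Sum>k\<in>?K. eq_coeff ?P k u * \<pi> k) * x u)
        = (\<Sum>k\<in>?K. \<Sum>u\<in>players C. \<pi> k * (eq_coeff ?P k u * x u))"
      by (subst sum.swap) (simp add: sum_distrib_left sum_distrib_right mult_ac)
    also have "\<dots> = (\<Sum>k\<in>?K. \<pi> k * (outflow C x k - inflow C x k))"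
      by (simp only: sum_distrib_left[symmetric] eq_row_clearing[OF assms])
    finally show ?thesis
      by (simp add: sum_negf[symmetric] algebra_simps)
  qed
  have 2: "(\<Sum>u\<in>players C. (\<Sum>r\<in>players C. le_coeff ?P r u * lam r) * x u)
      = (\<Sum>u\<in>players C. lam u * x u)"
  proof -
    have "(\<Sum>u\<in>players C. (\<Sum>r\<in>players C. le_coeff ?P r u * lam r) * x u)
        = (\<Sum>r\<in>players C. \<Sum>u\<in>players C. lam r * (le_coeff ?P r u * x u))"
      by (subst sum.swap) (simp add: sum_distrib_left sum_distrib_right mult_ac)
    also have "\<dots> = (\<Sum>r\<in>players C. lam r * (\<Sum>u\<in>players C. le_coeff ?P r u * x u))"
      by (simp only: sum_distrib_left)
    also have "\<dots> = (\<Sum>r\<in>players C. lam r * x r)"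
      by (rule sum.cong) (simp_all add: le_row_clearing[OF assms])
    finally show ?thesis .
  qed
  have 3: "(\<Sum>u\<in>players C. lp_cost ?P u * x u) = clearing_objective C x"
    using lp_objective_clearing[OF assms, of x] by (simp add: lp_objective_def clearing_lp_def)
  show ?thesis
    unfolding lp_dual_objective_clearing lagrangian_def left_diff_distrib distrib_right
      sum_subtractf sum.distrib 1 2 3
    by (simp add: sum_subtractf right_diff_distrib mult.commute)
qed

end

theory Submission
  imports Defs
begin

text \<open>An optimal dual solution is in particular feasible. The dual has one constraint per player, and
  the four families of inequalities are these constraints written out for the four kinds of players.

  The constraint of player \<open>u\<close> has coefficients given by the unit flow of \<open>u\<close>: it says that the
  objective at this flow is at most \<open>lam u\<close> plus the value, at the prices \<open>\<pi>\<close>, of what the flow takes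
  out of the space-time nodes minus the value of what it brings in (\<open>dual_constraint\<close>). The capacity
  rows form an identity matrix, hence the single multiplier \<open>lam u\<close>. A unit flow touches the
  clearing constraints of at most two space-time nodes, and at each of them only the products that
  \<open>u\<close> handles, so that the value brought in minus the value taken out collapses to the stakeholder
  price of \<open>u\<close>, negated for consumers (\<open>sum_at_node\<close> and the four lemmas on unit flow values). The
  objective at the unit flow is the bid of consumers and the negated bid of all other players. Both
  signs are thus opposite for consumers, and this is why they obtain the reverse inequality.\<close>

lemma dual_constraint:
  assumes "valid_supply_chain C" "lp_dual_feasible (clearing_lp C) \<pi> lam" "u \<in> players C"
  shows "clearing_objective C (unit_flow u)
    + (\<Sum>k\<in>st_nodes C \<times> products C. inflow C (unit_flow u) k * \<pi> k)
    - (\<Sum>k\<in>st_nodes C \<times> products C. outflow C (unit_flow u) k * \<pi> k) \<le> lam u"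
proof -
  have "(\<Sum>r\<in>players C. unit_flow u r * lam r) = (\<Sum>r\<in>players C. if r = u then lam r else 0)"
    by (rule sum.cong) (auto simp: unit_flow_def)
  also have "\<dots> = lam u"
    using assms(3) finite_players[OF assms(1)] by simp
  finally have "(\<Sum>r\<in>players C. unit_flow u r * lam r) = lam u" .
  moreover have "clearing_objective C (unit_flow u) \<le>
      (\<Sum>k\<in>st_nodes C \<times> products C.
        (outflow C (unit_flow u) k - inflow C (unit_flow u) k) * \<pi> k)
      + (\<Sum>r\<in>players C. unit_flow u r * lam r)"
    using assms(2,3) by (simp add: lp_dual_feasible_def clearing_lp_def)
  ultimately show ?thesis
    by (simp add: left_diff_distrib sum_subtractf)
qed

text \<open>The first factor below is the shape of every nonzero inflow or outflow of a unit flow: it is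
  concentrated at one space-time node \<open>s\<close> and on a set \<open>Q\<close> of products. For technologies, \<open>y\<close>
  collects the yields; for all other players \<open>Q\<close> is a singleton and \<open>y\<close> is constantly \<open>1\<close>.\<close>

lemma sum_at_node:
  fixes y :: "'p \<Rightarrow> real"
  assumes "finite S" "finite P" "s \<in> S" "Q \<subseteq> P"
  shows "(\<Sum>k\<in>S \<times> P. (if fst k = s \<and> snd k \<in> Q then y (snd k) else 0) * \<pi> k)
    = (\<Sum>p\<in>Q. y p * \<pi> (s, p))"
proof -
  have "(\<Sum>k\<in>S \<times> P. (if fst k = s \<and> snd k \<in> Q then y (snd k) else 0) * \<pi> k)
      = (\<Sum>k\<in>Pair s ` Q. (if fst k = s \<and> snd k \<in> Q then y (snd k) else 0) * \<pi> k)"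
    using assms by (intro sum.mono_neutral_right) auto
  then show ?thesis
    by (simp add: sum.reindex inj_on_def)
qed

lemma finite_st_nodes: "valid_supply_chain C \<Longrightarrow> finite (st_nodes C)"
  by (simp add: st_nodes_def valid_supply_chain_def)

lemma finite_products: "valid_supply_chain C \<Longrightarrow> finite (products C)"
  by (simp add: valid_supply_chain_def)

lemma inflow_unit_flow:
  assumes "valid_supply_chain C"
  shows "i \<in> suppliers C \<Longrightarrow> inflow C (unit_flow (Supplier i)) =
      (\<lambda>k. if fst k = sup_node C i \<and> snd k \<in> {sup_product C i} then 1 else 0)"
    and "inflow C (unit_flow (Consumer j)) = (\<lambda>k. 0)"
    and "l \<in> transporters C \<Longrightarrow> inflow C (unit_flow (Transporter l)) =
      (\<lambda>k. if fst k = recv_node C l \<and> snd k \<in> {trans_product C l} then 1 else 0)"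
    and "m \<in> technologies C \<Longrightarrow> inflow C (unit_flow (Technology m)) =
      (\<lambda>k. if fst k = tech_node C m \<and> snd k \<in> tech_gen C m then tech_yield C m (snd k) else 0)"
  using assms
  by (auto simp: inflow_def unit_flow_def suppliers_at_def transporters_in_def
      technologies_gen_def valid_supply_chain_def if_distrib cong: if_cong)

lemma outflow_unit_flow:
  assumes "valid_supply_chain C"
  shows "outflow C (unit_flow (Supplier i)) = (\<lambda>k. 0)"
    and "j \<in> consumers C \<Longrightarrow> outflow C (unit_flow (Consumer j)) =
      (\<lambda>k. if fst k = con_node C j \<and> snd k \<in> {con_product C j} then 1 else 0)"
    and "l \<in> transporters C \<Longrightarrow> outflow C (unit_flow (Transporter l)) =
      (\<lambda>k. if fst k = base_node C l \<and> snd k \<in> {trans_product C l} then 1 else 0)"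
    and "m \<in> technologies C \<Longrightarrow> outflow C (unit_flow (Technology m)) =
      (\<lambda>k. if fst k = tech_node C m \<and> snd k \<in> tech_con C m then tech_yield C m (snd k) else 0)"
  using assms
  by (auto simp: outflow_def unit_flow_def consumers_at_def transporters_out_def
      technologies_con_def valid_supply_chain_def if_distrib cong: if_cong)

lemma supplier_unit_flow_value:
  assumes "valid_supply_chain C" "i \<in> suppliers C"
  shows "(\<Sum>k\<in>st_nodes C \<times> products C. inflow C (unit_flow (Supplier i)) k * \<pi> k)
    - (\<Sum>k\<in>st_nodes C \<times> products C. outflow C (unit_flow (Supplier i)) k * \<pi> k)
    = supplier_price C \<pi> i"
proof -
  have "sup_node C i \<in> st_nodes C" "{sup_product C i} \<subseteq> products C"
    using assms by (auto simp: valid_supply_chain_def)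
  then show ?thesis
    using assms
    by (simp only: inflow_unit_flow outflow_unit_flow sum_at_node[where y = "\<lambda>_. 1"]
        finite_st_nodes finite_products)
      (simp add: supplier_price_def)
qed

lemma consumer_unit_flow_value:
  assumes "valid_supply_chain C" "j \<in> consumers C"
  shows "(\<Sum>k\<in>st_nodes C \<times> products C. inflow C (unit_flow (Consumer j)) k * \<pi> k)
    - (\<Sum>k\<in>st_nodes C \<times> products C. outflow C (unit_flow (Consumer j)) k * \<pi> k)
    = - consumer_price C \<pi> j"
proof -
  have "con_node C j \<in> st_nodes C" "{con_product C j} \<subseteq> products C"
    using assms by (auto simp: valid_supply_chain_def)
  then show ?thesis
    using assms
    by (simp only: inflow_unit_flow outflow_unit_flow sum_at_node[where y = "\<lambda>_. 1"]
        finite_st_nodes finite_products)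
      (simp add: consumer_price_def)
qed

text \<open>Inflow and outflow are priced separately, so that a transporter whose base and receiving
  nodes coincide needs no special treatment: its two contributions cancel.\<close>

lemma transporter_unit_flow_value:
  assumes "valid_supply_chain C" "l \<in> transporters C"
  shows "(\<Sum>k\<in>st_nodes C \<times> products C. inflow C (unit_flow (Transporter l)) k * \<pi> k)
    - (\<Sum>k\<in>st_nodes C \<times> products C. outflow C (unit_flow (Transporter l)) k * \<pi> k)
    = transporter_price C \<pi> l"
proof -
  have "recv_node C l \<in> st_nodes C" "base_node C l \<in> st_nodes C"
      "{trans_product C l} \<subseteq> products C"
    using assms by (auto simp: valid_supply_chain_def)
  then show ?thesis
    using assms
    by (simp only: inflow_unit_flow outflow_unit_flow sum_at_node[where y = "\<lambda>_. 1"]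
        finite_st_nodes finite_products)
      (simp add: transporter_price_def)
qed

lemma technology_unit_flow_value:
  assumes "valid_supply_chain C" "m \<in> technologies C"
  shows "(\<Sum>k\<in>st_nodes C \<times> products C. inflow C (unit_flow (Technology m)) k * \<pi> k)
    - (\<Sum>k\<in>st_nodes C \<times> products C. outflow C (unit_flow (Technology m)) k * \<pi> k)
    = technology_price C \<pi> m"
proof -
  have "tech_node C m \<in> st_nodes C" "tech_gen C m \<subseteq> products C" "tech_con C m \<subseteq> products C"
    using assms by (auto simp: valid_supply_chain_def)
  then show ?thesis
    using assms
    by (simp only: inflow_unit_flow outflow_unit_flow sum_at_node finite_st_nodes finite_products)
      (simp add: technology_price_def)
qed

lemma clearing_objective_unit_flow:
  assumes "valid_supply_chain C"
  shows "i \<in> suppliers C \<Longrightarrow> clearing_objective C (unit_flow (Supplier i)) = - sup_bid C i"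
    and "j \<in> consumers C \<Longrightarrow> clearing_objective C (unit_flow (Consumer j)) = con_bid C j"
    and "l \<in> transporters C \<Longrightarrow>
      clearing_objective C (unit_flow (Transporter l)) = - trans_bid C l"
    and "m \<in> technologies C \<Longrightarrow>
      clearing_objective C (unit_flow (Technology m)) = - tech_bid C m"
  using assms
  by (auto simp: clearing_objective_def unit_flow_def valid_supply_chain_def if_distrib
      cong: if_cong)

theorem theorem6:
  fixes C :: "('n, 't::linorder, 'p, 'g, 'd, 'l, 'm) supply_chain"
    and \<pi> :: "('n \<times> 't) \<times> 'p \<Rightarrow> real"
    and lam :: "('g, 'd, 'l, 'm) player \<Rightarrow> real"
  assumes "valid_supply_chain C"
    and "clearing_dual_optimal C \<pi> lam"
  shows "(\<forall>i\<in>suppliers C. supplier_price C \<pi> i - lam (Supplier i) \<le> sup_bid C i) \<and>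
    (\<forall>j\<in>consumers C. consumer_price C \<pi> j + lam (Consumer j) \<ge> con_bid C j) \<and>
    (\<forall>l\<in>transporters C. transporter_price C \<pi> l - lam (Transporter l) \<le> trans_bid C l) \<and>
    (\<forall>m\<in>technologies C. technology_price C \<pi> m - lam (Technology m) \<le> tech_bid C m)"
proof -
  have "lp_dual_feasible (clearing_lp C) \<pi> lam"
    using assms(2) by (simp add: clearing_dual_optimal_def lp_dual_optimal_def)
  note constraint = dual_constraint[OF assms(1) this]
  show ?thesis
  proof (intro conjI ballI)
    fix i assume i: "i \<in> suppliers C"
    then show "supplier_price C \<pi> i - lam (Supplier i) \<le> sup_bid C i"
      using constraint[of "Supplier i"] supplier_unit_flow_value[OF assms(1) i, of \<pi>]
        clearing_objective_unit_flow(1)[OF assms(1) i]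
      by (simp add: players_def)
  next
    fix j assume j: "j \<in> consumers C"
    then show "consumer_price C \<pi> j + lam (Consumer j) \<ge> con_bid C j"
      using constraint[of "Consumer j"] consumer_unit_flow_value[OF assms(1) j, of \<pi>]
        clearing_objective_unit_flow(2)[OF assms(1) j]
      by (simp add: players_def)
  next
    fix l assume l: "l \<in> transporters C"
    then show "transporter_price C \<pi> l - lam (Transporter l) \<le> trans_bid C l"
      using constraint[of "Transporter l"] transporter_unit_flow_value[OF assms(1) l, of \<pi>]
        clearing_objective_unit_flow(3)[OF assms(1) l]
      by (simp add: players_def)
  next
    fix m assume m: "m \<in> technologies C"
    then show "technology_price C \<pi> m - lam (Technology m) \<le> tech_bid C m"
      using constraint[of "Technology m"] technology_unit_flow_value[OF assms(1) m, of \<pi>]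
        clearing_objective_unit_flow(4)[OF assms(1) m]
      by (simp add: players_def)
  qed
qed

end
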